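(* Let $A\colon\mathbb{R}\to\mathfrak{sp}(\mathbb{R}^{2n})$ be continuous and let $(q,p)^{\mathrm{T}}$, with $q,p\colon\mathbb{R}\to\mathbb{R}^{n\times n}$, be a path of symplectic frames solving $\partial\begin{pmatrix} q \\ p \end{pmatrix}=A\begin{pmatrix} q \\ p \end{pmatrix}$. Let $s=pq^{-1}$, which is a real symmetric matrix wherever $q(x)$ is invertible. Assume that the points $x\in\mathbb{R}$ at which the Lagrangian plane spanned by the columns of $(q(x),p(x))^{\mathrm{T}}$ intersects the standard reference plane nontrivially are isolated, and let $x_0\in\mathbb{R}$ be such a point. Then the following integers are equal: (1) the unsigned integer jump in the Maslov index of the path of Lagrangian planes (relative to the standard reference plane) at $x_0$; (2) the rank loss in $q$ at $x_0$, i.e. $n-\mathrm{rank}\,q(x_0)$; (3) the rank loss in the total frame matrix at $x_0$, i.e. $2n-\mathrm{rank}\begin{pmatrix} q(x_0) & O \\ p(x_0) & \mathrm{id} \end{pmatrix}$; (4) the dimension of the intersection of the Lagrangian plane spanned by the columns of $(q(x_0),p(x_0))^{\mathrm{T}}$ with the standard reference plane; (5) the number of singular eigenvalues of $s$ at $x_0$.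
   Context: $\mathfrak{sp}(\mathbb{R}^{2n})$ is the Lie algebra of real $2n\times2n$ block matrices $A=\begin{pmatrix} a & b \\ c & d \end{pmatrix}$ with $a,b,c,d\in\mathbb{R}^{n\times n}$, $b$ and $c$ symmetric and $a=-d^{\mathrm{T}}$; $\partial$ denotes the derivative with respect to $x\in\mathbb{R}$. A symplectic frame is a real $2n\times n$ matrix $\begin{pmatrix} q \\ p \end{pmatrix}$ of rank $n$ with $q^{\mathrm{T}}p=p^{\mathrm{T}}q$; its column span is a Lagrangian plane in $\mathbb{R}^{2n}$. The standard reference plane is the span of the columns of $\begin{pmatrix} O \\ \mathrm{id} \end{pmatrix}$. The total frame matrix is the $2n\times2n$ matrix $\begin{pmatrix} q & O \\ p & \mathrm{id} \end{pmatrix}$. Maslov index: it counts, with multiplicity and sign, the intersections of the path of Lagrangian planes with the reference plane; the multiplicity contribution at each intersection is generated by the dimension of the intersection, and the sign by the direction of passage. The unsigned integer jump at $x_0$ is this multiplicity contribution, disregarding the direction of crossing. Singular eigenvalues: near $x_0$, for $x\neq x_0$, let $\mu_1(x),\dots,\mu_n(x)$ be the (real) eigenvalues of $s(x)$ counted with multiplicity (labelled, say, so that $|\mu_1(x)|\leqslant\dots\leqslant|\mu_n(x)|$). The eigenvalue $\mu_i$ is singular at $x_0$ if $\lim_{x\to x_0}|\mu_i(x)|=\infty$; the number of singular eigenvalues is the number of indices $i$ for which this holds. *)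

theory Defs
  imports "HOL-Analysis.Analysis" "HOL-Computational_Algebra.Polynomial"
begin

text \<open>The index type \<open>'n + 'n\<close> labels the coordinates of the \<open>2n\<close>-dimensional space, \<open>n\<close>
  being \<open>CARD('n)\<close>: \<open>Inl\<close> for the upper half, \<open>Inr\<close> for the lower half.\<close>

definition block_mat ::
  "'a^'n^'n \<Rightarrow> 'a^'n^'n \<Rightarrow> 'a^'n^'n \<Rightarrow> 'a^'n^'n \<Rightarrow> 'a^('n + 'n)^('n + 'n)"
  where "block_mat a b c d = (\<chi> i j. case i of
      Inl k \<Rightarrow> (case j of Inl l \<Rightarrow> a $ k $ l | Inr l \<Rightarrow> b $ k $ l)
    | Inr k \<Rightarrow> (case j of Inl l \<Rightarrow> c $ k $ l | Inr l \<Rightarrow> d $ k $ l))"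

definition frame_mat :: "'a^'n^'n \<Rightarrow> 'a^'n^'n \<Rightarrow> 'a^'n^('n + 'n)"
  where "frame_mat q p = (\<chi> i. case i of Inl k \<Rightarrow> q $ k | Inr k \<Rightarrow> p $ k)"

definition sp_algebra :: "(real^('n::finite + 'n)^('n + 'n)) set"
  where "sp_algebra = {block_mat a b c d | a b c d.
    transpose b = b \<and> transpose c = c \<and> a = - transpose d}"

definition symplectic_frame :: "real^'n^'n \<Rightarrow> real^'n^'n \<Rightarrow> bool"
  where "symplectic_frame q p \<longleftrightarrow>
    rank (frame_mat q p) = CARD('n) \<and> transpose q ** p = transpose p ** q"

definition total_frame :: "real^'n^'n \<Rightarrow> real^'n^'n \<Rightarrow> real^('n + 'n)^('n + 'n)"
  where "total_frame q p = block_mat q 0 p (mat 1)"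

definition frame_plane :: "real^'n^'n \<Rightarrow> real^'n^'n \<Rightarrow> (real^('n + 'n)) set"
  where "frame_plane q p = span (columns (frame_mat q p))"

definition reference_plane :: "(real^('n::finite + 'n)) set"
  where "reference_plane = frame_plane 0 (mat 1)"

definition crossings :: "(real \<Rightarrow> 'v::euclidean_space set) \<Rightarrow> 'v set \<Rightarrow> real set"
  where "crossings L V = {x. L x \<inter> V \<noteq> {0}}"

text \<open>The Maslov index of \<open>L\<close> over \<open>[a, b]\<close>, disregarding the direction of crossing: every
  intersection with \<open>V\<close> counts positively, with the dimension of the intersection as its
  multiplicity. The sum is meaningful only if there are finitely many crossings in \<open>[a, b]\<close>
  (otherwise it is 0 by convention). The signs have to be dropped before summing: a path can
  leave and enter \<open>V\<close> in different directions at the same point, and the contributions to the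
  signed index may then cancel.\<close>

definition unsigned_maslov_index ::
  "(real \<Rightarrow> 'v::euclidean_space set) \<Rightarrow> 'v set \<Rightarrow> real \<Rightarrow> real \<Rightarrow> nat"
  where "unsigned_maslov_index L V a b = (\<Sum>x\<in>crossings L V \<inter> {a..b}. dim (L x \<inter> V))"

text \<open>\<open>m\<close> is the amount by which the unsigned index, started at any \<open>a < x0\<close>, jumps as its
  endpoint passes \<open>x0\<close>. One-sided limits of a natural-number-valued function are values
  that it takes near the point.\<close>

definition has_unsigned_maslov_jump ::
  "(real \<Rightarrow> 'v::euclidean_space set) \<Rightarrow> 'v set \<Rightarrow> real \<Rightarrow> nat \<Rightarrow> bool"
  where "has_unsigned_maslov_jump L V x0 m \<longleftrightarrow>
    (\<forall>a<x0. \<exists>l r. (unsigned_maslov_index L V a \<longlongrightarrow> l) (at_left x0) \<and>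
                 (unsigned_maslov_index L V a \<longlongrightarrow> r) (at_right x0) \<and> r = l + m)"

definition char_poly_mat :: "'a::comm_ring_1^'n^'n \<Rightarrow> 'a poly"
  where "char_poly_mat A = det (\<chi> i j. (if i = j then [:0, 1:] else 0) - [:A $ i $ j:])"

text \<open>The real eigenvalues with algebraic multiplicity, labelled from 0 in order of increasing
  absolute value. The list has length \<open>n\<close> when \<open>A\<close> is symmetric.\<close>

definition eigenvalues_by_abs :: "real^'n^'n \<Rightarrow> real list"
  where "eigenvalues_by_abs A =
    sort_key abs (sorted_list_of_multiset (proots (char_poly_mat A)))"

definition singular_eigenvalue_indices :: "(real \<Rightarrow> real^'n^'n) \<Rightarrow> real \<Rightarrow> nat set"
  where "singular_eigenvalue_indices s x0 =
    {i. i < CARD('n) \<and> filterlim (\<lambda>x. \<bar>eigenvalues_by_abs (s x) ! i\<bar>) at_top (at x0)}"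

end

theory Submission
  imports Defs
begin

text \<open>All the counts are the dimension of the kernel of \<open>q(x\<^sub>0)\<close>. The interesting one is the number of
  singular eigenvalues. The matrix \<open>s = pq\<^sup>-\<^sup>1\<close> maps \<open>q u\<close> to \<open>p u\<close>. For \<open>u\<close> in the kernel of
  \<open>q(x\<^sub>0)\<close>, where \<open>p(x\<^sub>0)\<close> is injective because the frame has full rank, the quotient
  \<open>\<parallel>p u\<parallel> / \<parallel>q u\<parallel>\<close> tends to infinity uniformly as \<open>x\<close> tends to \<open>x\<^sub>0\<close>; for \<open>u\<close> in the orthogonal
  complement of this kernel it stays bounded. As \<open>s\<close> is symmetric, each of these two subspaces,
  transported by \<open>q(x)\<close>, bounds the corresponding number of eigenvalues of \<open>s(x)\<close> by the usual
  dimension count.\<close>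

subsection \<open>Diagonalization of symmetric matrices\<close>

text \<open>For small \<open>t\<close> the linear term dominates, and it changes sign with
  \<open>t\<close>. This is the first-order condition at an extremum of a quadratic form.\<close>

lemma quadratic_nonneg_imp_linear_coeff_0:
  fixes b c :: real
  assumes "\<And>t. 0 \<le> t * b + t\<^sup>2 * c"
  shows "b = 0"
proof (rule ccontr)
  assume "b \<noteq> 0"
  \<comment> \<open>Any positive \<open>k > c\<close> would do: at \<open>t = - b / k\<close> the
    polynomial equals \<open>b\<^sup>2 / k\<^sup>2\<close> times \<open>c - k\<close>.\<close>
  define k where "k = \<bar>c\<bar> + 1"
  have k: "k > 0" "c < k" by (auto simp: k_def)
  have "0 \<le> (- b / k) * b + (- b / k)\<^sup>2 * c" using assms .
  also have "\<dots> = (b\<^sup>2 / k\<^sup>2) * (c - k)"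
    using k by (simp add: field_simps power2_eq_square)
  also have "\<dots> < 0"
    using k \<open>b \<noteq> 0\<close> by (intro mult_pos_neg) auto
  finally show False by simp
qed

text \<open>The quadratic form of \<open>f\<close> attains a maximum on the unit sphere of
  \<open>V\<close>, by compactness, and a maximiser is an eigenvector with the maximum as its
  eigenvalue.\<close>

lemma self_adjoint_eigenvector_exists:
  fixes f :: "'a::euclidean_space \<Rightarrow> 'a"
  assumes f: "linear f" and sym: "\<And>x y. f x \<bullet> y = x \<bullet> f y"
    and V: "subspace V" "V \<noteq> {0}" and inv: "f ` V \<subseteq> V"
  obtains u m where "u \<in> V" "norm u = 1" "f u = m *\<^sub>R u"
proof -
  interpret linear f by fact
  let ?K = "V \<inter> sphere 0 1"
  have "compact ?K"
    by (intro closed_Int_compact closed_subspace V compact_sphere)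
  moreover have "?K \<noteq> {}"
  proof -
    obtain v where "v \<in> V" "v \<noteq> 0" using V subspace_0 by blast
    then have "v /\<^sub>R norm v \<in> ?K" using V by (auto simp: subspace_scale)
    then show ?thesis by blast
  qed
  moreover have "continuous_on ?K (\<lambda>x. x \<bullet> f x)"
    by (intro continuous_intros linear_continuous_on) (simp add: f linear_conv_bounded_linear[symmetric])
  ultimately obtain u where u: "u \<in> ?K" and umax: "\<And>x. x \<in> ?K \<Longrightarrow> x \<bullet> f x \<le> u \<bullet> f u"
    using continuous_attains_sup by metis
  define m where "m = u \<bullet> f u"
  have uu: "u \<bullet> u = 1" using u by (simp add: norm_eq_1[symmetric])
  have form: "w \<bullet> f w \<le> m * (w \<bullet> w)" if "w \<in> V" for w
  proof (cases "w = 0")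
    case False
    then have "w /\<^sub>R norm w \<in> ?K" using V that by (auto simp: subspace_scale)
    from umax[OF this] have "(w \<bullet> f w) / (norm w)\<^sup>2 \<le> m"
      by (simp add: m_def scale power2_eq_square divide_inverse mult_ac)
    with False show ?thesis by (simp add: divide_le_eq dot_square_norm)
  qed (simp add: zero)
  \<comment> \<open>By \<open>form\<close>, \<open>m * (w \<bullet> w) - w \<bullet> f w\<close> is
    nonnegative on \<open>V\<close>, and it vanishes at \<open>u\<close>. So its first variation at
    \<open>u\<close> in the direction \<open>v\<close> is zero.\<close>
  have orth: "(m *\<^sub>R u - f u) \<bullet> v = 0" if "v \<in> V" for v
  proof -
    have "0 \<le> t * (2 * ((m *\<^sub>R u - f u) \<bullet> v)) + t\<^sup>2 * (m * (v \<bullet> v) - v \<bullet> f v)" for t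
    proof -
      have "u + t *\<^sub>R v \<in> V" using u that V by (simp add: subspace_add subspace_scale)
      from form[OF this] show ?thesis
        using sym[of u v] by (simp add: add scale inner_simps uu algebra_simps
            power2_eq_square inner_commute m_def[symmetric])
    qed
    from quadratic_nonneg_imp_linear_coeff_0[OF this] show ?thesis by simp
  qed
  \<comment> \<open>Invariance of \<open>V\<close> enters here: the difference lies in
    \<open>V\<close> and is orthogonal to all of \<open>V\<close>, hence to itself.\<close>
  have "m *\<^sub>R u - f u \<in> V"
    using u inv V by (auto intro!: subspace_diff subspace_scale)
  with orth have "f u = m *\<^sub>R u" by (metis eq_iff_diff_eq_0 inner_eq_zero_iff)
  then show thesis using that u by auto
qed

text \<open>Induction on the dimension: split off a unit eigenvector and continue in its orthogonal
  complement within \<open>V\<close>, which is invariant because \<open>f\<close> is self-adjoint.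
  This is why the claim is made for invariant subspaces and not only for the whole space.\<close>

lemma self_adjoint_orthonormal_eigenbasis:
  fixes f :: "'a::euclidean_space \<Rightarrow> 'a"
  assumes f: "linear f" and sym: "\<And>x y. f x \<bullet> y = x \<bullet> f y"
    and V: "subspace V" and inv: "f ` V \<subseteq> V"
  shows "\<exists>B\<subseteq>V. finite B \<and> card B = dim V \<and> pairwise orthogonal B \<and>
    (\<forall>u\<in>B. norm u = 1 \<and> (\<exists>m. f u = m *\<^sub>R u))"
  using V inv
proof (induction "dim V" arbitrary: V)
  case 0
  then show ?case by (intro exI[of _ "{}"]) auto
next
  case (Suc k)
  then have "V \<noteq> {0}" by auto
  with Suc.prems obtain u m where u: "u \<in> V" "norm u = 1" "f u = m *\<^sub>R u"
    using self_adjoint_eigenvector_exists[OF f sym] by metis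
  let ?W = "{y \<in> V. \<forall>x\<in>span {u}. orthogonal x y}"
  have W: "?W = {y \<in> V. u \<bullet> y = 0}"
    by (auto simp: span_singleton orthogonal_def)
  have "dim ?W + dim (span {u}) = dim V"
    using u Suc.prems by (intro dim_subspace_orthogonal_to_vectors span_minimal) auto
  moreover have "dim (span {u}) = 1" using u by (auto simp: dim_insert)
  ultimately have k: "k = dim ?W" using Suc.hyps by simp
  have sub: "subspace ?W"
    unfolding W using Suc.prems(1) by (auto simp: subspace_def inner_simps)
  have "f ` ?W \<subseteq> ?W"
  proof -
    have "u \<bullet> f y = 0" if "u \<bullet> y = 0" for y using sym[of u y] that u by simp
    then show ?thesis unfolding W using Suc.prems(2) by auto
  qed
  from Suc.hyps(1)[OF k sub this] obtain B where B: "B \<subseteq> ?W" "finite B" "card B = dim ?W"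
    "pairwise orthogonal B" "\<forall>u\<in>B. norm u = 1 \<and> (\<exists>m. f u = m *\<^sub>R u)" by auto
  have "u \<notin> B" using B(1) u unfolding W by (auto simp: norm_eq_1)
  moreover have "pairwise orthogonal (insert u B)"
    using B(1,4) unfolding W by (auto simp: pairwise_insert orthogonal_def inner_commute)
  ultimately show ?case
    using B u k Suc.hyps(2) by (intro exI[of _ "insert u B"]) auto
qed

definition diag_mat :: "('n \<Rightarrow> 'a::zero) \<Rightarrow> 'a^'n^'n"
  where "diag_mat d = (\<chi> i j. if i = j then d i else 0)"

lemma diag_mat_mult_vec: "diag_mat d *v y = (\<chi> i. d i * y $ i)"
  for d :: "'n::finite \<Rightarrow> 'a::semiring_1"
  by (simp add: diag_mat_def matrix_vector_mult_def vec_eq_iff if_distrib[of "\<lambda>x. x * _"] cong: if_cong)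

text \<open>The columns of \<open>P\<close> are an orthonormal eigenbasis, indexed by
  \<open>'n\<close> through an arbitrary bijection. The order of the entries of \<open>d\<close>
  therefore carries no information.\<close>

theorem symmetric_matrix_diagonalization:
  fixes S :: "real^'n^'n"
  assumes "transpose S = S"
  obtains P d where "orthogonal_matrix P" "S = P ** diag_mat d ** transpose P"
proof -
  have "(S *v x) \<bullet> y = x \<bullet> (S *v y)" for x y
    by (metis assms dot_lmul_matrix vector_transpose_matrix)
  from self_adjoint_orthonormal_eigenbasis[OF matrix_vector_mul_linear this, of UNIV]
  obtain B where B: "finite B" "card B = CARD('n)" "pairwise orthogonal B"
    "\<forall>u\<in>B. norm u = 1 \<and> (\<exists>m. S *v u = m *\<^sub>R u)" by auto
  then obtain f where f: "bij_betw f (UNIV :: 'n set) B"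
    using finite_same_card_bij[of "UNIV :: 'n set" B] by auto
  then have "\<forall>i. \<exists>m. S *v f i = m *\<^sub>R f i" using B(4) bij_betwE by blast
  then obtain d where d: "\<And>i. S *v f i = d i *\<^sub>R f i" by metis
  define P where "P = (\<chi> i j. f j $ i)"
  have "\<And>i. norm (f i) = 1" "\<And>i j. i \<noteq> j \<Longrightarrow> orthogonal (f i) (f j)"
    using B f by (auto simp: pairwise_def bij_betw_def) (metis injD rangeI)
  then have P: "orthogonal_matrix P"
    by (simp add: orthogonal_matrix_orthonormal_columns column_def P_def)
  have "(S ** P) $ i $ j = (P ** diag_mat d) $ i $ j" for i j
  proof -
    have "(S ** P) $ i $ j = (S *v f j) $ i"
      by (simp add: matrix_matrix_mult_def matrix_vector_mult_def P_def)
    then show ?thesis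
      by (simp add: d matrix_matrix_mult_def diag_mat_def P_def if_distrib mult.commute cong: if_cong)
  qed
  then have "S ** P = P ** diag_mat d" by (simp add: vec_eq_iff)
  then have "S = P ** diag_mat d ** transpose P"
    using P by (metis matrix_mul_assoc matrix_mul_rid orthogonal_matrix_def)
  with P that show thesis by blast
qed

section \<open>Characteristic polynomials: conjugation and diagonal matrices\<close>

definition const_poly_mat :: "'a::zero^'n^'m \<Rightarrow> 'a poly^'n^'m"
  where "const_poly_mat A = (\<chi> i j. [:A $ i $ j:])"

lemma const_poly_mat_mult:
  fixes A :: "'a::comm_semiring_1^'n^'m" and B :: "'a^'k^'n"
  shows "const_poly_mat (A ** B) = const_poly_mat A ** const_poly_mat B"
proof -
  have const_poly_add: "[:a + b:] = [:a:] + [:b:]" for a b :: 'a by simp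
  have "[:\<Sum>i\<in>I. g i:] = (\<Sum>i\<in>I. [:g i:])" for I and g :: "'n \<Rightarrow> 'a"
    by (induction I rule: infinite_finite_induct) (simp_all add: const_poly_add del: add_pCons)
  then show ?thesis
    by (simp add: const_poly_mat_def matrix_matrix_mult_def vec_eq_iff mult.commute)
qed

lemma const_poly_mat_1: "const_poly_mat (mat 1 :: 'a::comm_semiring_1^'n^'n) = mat 1"
  by (simp add: const_poly_mat_def mat_def vec_eq_iff one_pCons)

lemma char_poly_mat_altdef: "char_poly_mat A = det (mat [:0, 1:] - const_poly_mat A)"
  unfolding char_poly_mat_def
  by (rule arg_cong[of _ _ det]) (simp add: const_poly_mat_def mat_def vec_eq_iff)

text \<open>Over the polynomial ring the scalar matrix of the indeterminate commutes with
  \<open>P\<close>. So the characteristic matrix of \<open>P ** A ** Q\<close> is that of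
  \<open>A\<close> multiplied by \<open>P\<close> and \<open>Q\<close>, whose determinants
  cancel.\<close>

lemma char_poly_mat_conjugate:
  fixes P :: "'a::comm_ring_1^'n^'n"
  assumes "P ** Q = mat 1"
  shows "char_poly_mat (P ** A ** Q) = char_poly_mat A"
proof -
  let ?C = "const_poly_mat :: 'a^'n^'n \<Rightarrow> 'a poly^'n^'n"
  have X: "M ** mat c = mat c ** M" for M :: "'a poly^'n^'n" and c
    by (simp add: matrix_matrix_mult_def mat_def vec_eq_iff if_distrib[of "\<lambda>x. x * _"]
        if_distrib[of "\<lambda>x. _ * x"] mult.commute cong: if_cong)
  have diff: "K ** (M - N) = K ** M - K ** N" "(M - N) ** K = M ** K - N ** K"
    for K M N :: "'a poly^'n^'n"
    by (simp_all add: matrix_matrix_mult_def vec_eq_iff sum_subtractf algebra_simps)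
  have PQ: "?C P ** ?C Q = mat 1"
    by (metis assms const_poly_mat_1 const_poly_mat_mult)
  have "mat [:0, 1:] = mat [:0, 1:] ** (?C P ** ?C Q)" by (simp add: PQ)
  also have "\<dots> = ?C P ** mat [:0, 1:] ** ?C Q" by (simp add: X[of "?C P"] matrix_mul_assoc)
  finally have "mat [:0, 1:] - ?C (P ** A ** Q) = ?C P ** (mat [:0, 1:] - ?C A) ** ?C Q"
    by (simp add: const_poly_mat_mult diff)
  then have "char_poly_mat (P ** A ** Q) = det (?C P ** ?C Q) * char_poly_mat A"
    by (simp add: char_poly_mat_altdef det_mul mult_ac)
  then show ?thesis by (simp add: PQ)
qed

lemma proots_char_poly_diag_mat:
  fixes d :: "'n::finite \<Rightarrow> 'a::idom"
  shows "proots (char_poly_mat (diag_mat d)) = image_mset d (mset_set UNIV)"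
proof -
  have "char_poly_mat (diag_mat d) = (\<Prod>i\<in>UNIV. [:- d i, 1:])"
    unfolding char_poly_mat_def by (subst det_diagonal) (auto simp: diag_mat_def)
  moreover have "proots (\<Prod>i\<in>UNIV. [:- d i, 1:]) = (\<Sum>i\<in>UNIV. {#d i#})"
    by (subst proots_prod) auto
  ultimately show ?thesis by (simp add: sum_unfold_sum_mset)
qed

subsection \<open>Counting eigenvalues by absolute value\<close>

lemma norm_orthogonal_matrix_mult:
  fixes P :: "real^'n^'n"
  assumes "orthogonal_matrix P"
  shows "norm (P *v y) = norm y"
proof -
  have "(P *v y) \<bullet> (P *v y) = y \<bullet> (transpose P ** P *v y)"
    using dot_lmul_matrix[of "P *v y" P y] transpose_matrix_vector[of P "P *v y"]
    by (simp add: inner_commute matrix_vector_mul_assoc)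
  then show ?thesis using assms by (simp add: orthogonal_matrix norm_eq_sqrt_inner)
qed

lemma disjoint_subspaces_dim_le:
  fixes V W :: "(real^'n) set"
  assumes "subspace V" "subspace W" "V \<inter> W \<subseteq> {0}"
  shows "dim V + dim W \<le> CARD('n)"
proof -
  have "dim (V \<inter> W) = 0" using assms(3) by simp
  with dim_sums_Int[OF assms(1,2)] have "dim V + dim W = dim {x + y |x y. x \<in> V \<and> y \<in> W}"
    by simp
  also have "\<dots> \<le> CARD('n)" using dim_subset_UNIV[of "{x + y |x y. x \<in> V \<and> y \<in> W}"] by simp
  finally show ?thesis .
qed

text \<open>\<open>E\<close> is the span of the columns of \<open>P\<close> with index in
  \<open>I\<close>. When \<open>P\<close> diagonalizes a matrix, these columns are
  eigenvectors.\<close>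

lemma spectral_subspace:
  fixes P :: "real^'n^'n" and I :: "'n set"
  assumes P: "orthogonal_matrix P"
  defines "E \<equiv> (*v) P ` {y. \<forall>i. i \<notin> I \<longrightarrow> y $ i = 0}"
  shows "subspace E" "dim E = card I"
proof -
  let ?Y = "{y :: real^'n. \<forall>i. i \<notin> I \<longrightarrow> y $ i = 0}"
  have Y: "subspace ?Y" by (auto simp: subspace_def)
  then show "subspace E" unfolding E_def by (intro linear_subspace_image matrix_vector_mul_linear)
  have "inj ((*v) P)"
    using P by (intro inj_matrix_vector_mult) (auto simp: orthogonal_matrix_def invertible_def)
  then have "dim E = dim ?Y" unfolding E_def
    by (intro dim_image_eq matrix_vector_mul_linear) (auto intro: inj_on_subset)
  also have "\<dots> = card I" using dim_substandard_cart[where 'a=real, of I] by (simp add: dim_vec_eq)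
  finally show "dim E = card I" .
qed

text \<open>Componentwise comparison on the support of \<open>y\<close>. With a constant diagonal
  \<open>M\<close> on one side or the other it serves large and small eigenvalues alike.\<close>

lemma norm_diag_mat_mult_strict_mono:
  fixes a b :: "'n::finite \<Rightarrow> real"
  assumes lt: "\<And>i. y $ i \<noteq> 0 \<Longrightarrow> \<bar>a i\<bar> < \<bar>b i\<bar>" and "y \<noteq> 0"
  shows "norm (diag_mat a *v y) < norm (diag_mat b *v y)"
proof -
  obtain k where k: "y $ k \<noteq> 0" using \<open>y \<noteq> 0\<close> by (auto simp: vec_eq_iff)
  have "\<bar>a i * y $ i\<bar> < \<bar>b i * y $ i\<bar>" if "y $ i \<noteq> 0" for i
    using lt[OF that] that by (simp add: abs_mult)
  then have sq: "(a i * y $ i)\<^sup>2 < (b i * y $ i)\<^sup>2" if "y $ i \<noteq> 0" for i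
    using that by (metis abs_le_square_iff not_le)
  have "(a i * y $ i)\<^sup>2 \<le> (b i * y $ i)\<^sup>2" for i
    using sq[of i] by (cases "y $ i = 0") auto
  then have "(\<Sum>i\<in>UNIV. (a i * y $ i)\<^sup>2) < (\<Sum>i\<in>UNIV. (b i * y $ i)\<^sup>2)"
    using sq[OF k] by (intro sum_strict_mono_ex1) auto
  then show ?thesis
    by (simp add: norm_lt inner_vec_def diag_mat_mult_vec power2_eq_square)
qed

lemma diag_mat_const_mult_vec: "diag_mat (\<lambda>_. M) *v y = M *\<^sub>R y" for y :: "real^'n"
  by (simp add: diag_mat_mult_vec vec_eq_iff)

lemma orthogonal_diagonalization_mult_vec:
  fixes P :: "real^'n^'n"
  assumes P: "orthogonal_matrix P" and S: "S = P ** diag_mat d ** transpose P"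
  shows "S *v (P *v y) = P *v (diag_mat d *v y)"
proof -
  have "S ** P = P ** diag_mat d"
    using P unfolding S orthogonal_matrix
    by (metis matrix_mul_assoc matrix_mul_rid)
  then show ?thesis by (simp add: matrix_vector_mul_assoc)
qed

text \<open>Both bounds say that \<open>W\<close> meets a sum of eigenspaces only in the origin.\<close>

lemma dim_le_codim_large_eigenvalues:
  fixes P :: "real^'n^'n"
  assumes P: "orthogonal_matrix P" and S: "S = P ** diag_mat d ** transpose P"
    and W: "subspace W" and le: "\<And>w. w \<in> W \<Longrightarrow> norm (S *v w) \<le> M * norm w" and "0 \<le> M"
  shows "dim W + card {i. \<bar>d i\<bar> > M} \<le> CARD('n)"
proof -
  let ?I = "{i. \<bar>d i\<bar> > M}"
  let ?E = "(*v) P ` {y. \<forall>i. i \<notin> ?I \<longrightarrow> y $ i = 0}"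
  have "W \<inter> ?E \<subseteq> {0}"
  proof clarsimp
    fix y assume y: "\<forall>i. \<not> M < \<bar>d i\<bar> \<longrightarrow> y $ i = 0" and Py: "P *v y \<in> W"
    have "norm (diag_mat d *v y) \<le> M * norm y"
      using le[OF Py] by (simp add: orthogonal_diagonalization_mult_vec[OF P S] norm_orthogonal_matrix_mult[OF P])
    moreover have "norm (diag_mat (\<lambda>_. M) *v y) < norm (diag_mat d *v y)" if "y \<noteq> 0"
      using y \<open>0 \<le> M\<close> that by (intro norm_diag_mat_mult_strict_mono) auto
    ultimately have "y = 0" using \<open>0 \<le> M\<close> by (fastforce simp: diag_mat_const_mult_vec)
    then show "P *v y = 0" by simp
  qed
  from disjoint_subspaces_dim_le[OF W spectral_subspace(1)[OF P] this] show ?thesis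
    by (subst (asm) spectral_subspace(2)[OF P])
qed

lemma dim_le_codim_small_eigenvalues:
  fixes P :: "real^'n^'n"
  assumes P: "orthogonal_matrix P" and S: "S = P ** diag_mat d ** transpose P"
    and W: "subspace W" and ge: "\<And>w. w \<in> W \<Longrightarrow> M * norm w \<le> norm (S *v w)"
  shows "dim W + card {i. \<bar>d i\<bar> < M} \<le> CARD('n)"
proof (cases "M > 0")
  case True
  let ?I = "{i. \<bar>d i\<bar> < M}"
  let ?E = "(*v) P ` {y. \<forall>i. i \<notin> ?I \<longrightarrow> y $ i = 0}"
  have "W \<inter> ?E \<subseteq> {0}"
  proof clarsimp
    fix y assume y: "\<forall>i. \<not> \<bar>d i\<bar> < M \<longrightarrow> y $ i = 0" and Py: "P *v y \<in> W"
    have "M * norm y \<le> norm (diag_mat d *v y)"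
      using ge[OF Py] by (simp add: orthogonal_diagonalization_mult_vec[OF P S] norm_orthogonal_matrix_mult[OF P])
    moreover have "norm (diag_mat d *v y) < norm (diag_mat (\<lambda>_. M) *v y)" if "y \<noteq> 0"
      using y True that by (intro norm_diag_mat_mult_strict_mono) auto
    ultimately have "y = 0" using True by (fastforce simp: diag_mat_const_mult_vec)
    then show "P *v y = 0" by simp
  qed
  from disjoint_subspaces_dim_le[OF W spectral_subspace(1)[OF P] this] show ?thesis
    by (subst (asm) spectral_subspace(2)[OF P])
next
  \<comment> \<open>No absolute value is below a nonpositive \<open>M\<close>, so only
    \<open>dim W \<le> CARD('n)\<close> is left to show.\<close>
  case False
  then have "{i. \<bar>d i\<bar> < M} = {}" by auto
  then have "card {i. \<bar>d i\<bar> < M} = 0" by (metis card.empty)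
  moreover have "dim W \<le> CARD('n)" using dim_subset_UNIV[of W] by simp
  ultimately show ?thesis by simp
qed

lemma mset_eigenvalues_by_abs:
  fixes P :: "real^'n^'n"
  assumes P: "orthogonal_matrix P" and S: "S = P ** diag_mat d ** transpose P"
  shows "mset (eigenvalues_by_abs S) = image_mset d (mset_set UNIV)"
proof -
  have "char_poly_mat S = char_poly_mat (diag_mat d)"
    unfolding S using P by (intro char_poly_mat_conjugate) (simp add: orthogonal_matrix_def)
  then show ?thesis by (simp add: eigenvalues_by_abs_def proots_char_poly_diag_mat)
qed

text \<open>The sorted list and the diagonal \<open>d\<close> are labelled differently but agree as
  multisets, so counts of entries with a given property carry over.\<close>

lemma card_indices_eigenvalues_by_abs:
  fixes P :: "real^'n^'n"
  assumes "orthogonal_matrix P" "S = P ** diag_mat d ** transpose P"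
  shows "card {i. i < CARD('n) \<and> Q (eigenvalues_by_abs S ! i)} = card {i. Q (d i)}"
proof -
  let ?xs = "eigenvalues_by_abs S"
  note m = mset_eigenvalues_by_abs[OF assms]
  have "length ?xs = CARD('n)" using arg_cong[OF m, of size] by simp
  then have "card {i. i < CARD('n) \<and> Q (?xs ! i)} = size (filter_mset Q (mset ?xs))"
    by (simp add: length_filter_conv_card flip: mset_filter)
  also have "\<dots> = card {i. Q (d i)}" by (simp add: m filter_mset_image_mset)
  finally show ?thesis .
qed

lemma eigenvalues_by_abs_mono:
  fixes S :: "real^'n^'n"
  assumes "transpose S = S" "i \<le> j" "j < CARD('n)"
  shows "\<bar>eigenvalues_by_abs S ! i\<bar> \<le> \<bar>eigenvalues_by_abs S ! j\<bar>"
proof -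
  obtain P d where P: "orthogonal_matrix P" "S = P ** diag_mat d ** transpose P"
    using symmetric_matrix_diagonalization[OF assms(1)] .
  have "length (eigenvalues_by_abs S) = CARD('n)"
    using arg_cong[OF mset_eigenvalues_by_abs[OF P], of size] by simp
  moreover have "sorted (map abs (eigenvalues_by_abs S))" by (simp add: eigenvalues_by_abs_def)
  ultimately show ?thesis using assms(2,3) sorted_nth_mono[of "map abs (eigenvalues_by_abs S)" i j] by simp
qed

text \<open>One half of a min-max principle for absolute values. If entry \<open>i\<close> exceeded
  \<open>M\<close>, so would all later ones, which makes \<open>CARD('n) - i\<close> large
  eigenvalues: too many beside \<open>W\<close>, as \<open>i < dim W\<close>.\<close>

lemma eigenvalues_by_abs_le:
  fixes S :: "real^'n^'n"
  assumes S: "transpose S = S" and W: "subspace W"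
    and le: "\<And>w. w \<in> W \<Longrightarrow> norm (S *v w) \<le> M * norm w" and M: "0 \<le> M" and i: "i < dim W"
  shows "\<bar>eigenvalues_by_abs S ! i\<bar> \<le> M"
proof (rule ccontr)
  assume gt: "\<not> ?thesis"
  obtain P d where P: "orthogonal_matrix P" "S = P ** diag_mat d ** transpose P"
    using symmetric_matrix_diagonalization[OF S] .
  have "{i..<CARD('n)} \<subseteq> {j. j < CARD('n) \<and> \<bar>eigenvalues_by_abs S ! j\<bar> > M}"
    using gt eigenvalues_by_abs_mono[OF S, of i] by force
  then have "card {i..<CARD('n)} \<le> card {j. \<bar>d j\<bar> > M}"
    unfolding card_indices_eigenvalues_by_abs[OF P, of "\<lambda>x. \<bar>x\<bar> > M", symmetric]
    by (intro card_mono) auto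
  with dim_le_codim_large_eigenvalues[OF P W le M] i show False by simp
qed

text \<open>The other half. If entry \<open>i\<close> were below \<open>M\<close>, so would be all
  earlier ones; counted from 0 these are \<open>i + 1\<close> entries, one more than the codimension
  of \<open>W\<close> allows.\<close>

lemma eigenvalues_by_abs_ge:
  fixes S :: "real^'n^'n"
  assumes S: "transpose S = S" and W: "subspace W"
    and ge: "\<And>w. w \<in> W \<Longrightarrow> M * norm w \<le> norm (S *v w)"
    and i: "CARD('n) - dim W \<le> i" "i < CARD('n)"
  shows "M \<le> \<bar>eigenvalues_by_abs S ! i\<bar>"
proof (rule ccontr)
  assume lt: "\<not> ?thesis"
  obtain P d where P: "orthogonal_matrix P" "S = P ** diag_mat d ** transpose P"
    using symmetric_matrix_diagonalization[OF S] .
  have "{..i} \<subseteq> {j. j < CARD('n) \<and> \<bar>eigenvalues_by_abs S ! j\<bar> < M}"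
    using lt eigenvalues_by_abs_mono[OF S _ i(2)] i(2) by force
  then have "card {..i} \<le> card {j. \<bar>d j\<bar> < M}"
    unfolding card_indices_eigenvalues_by_abs[OF P, of "\<lambda>x. \<bar>x\<bar> < M", symmetric]
    by (intro card_mono) auto
  with dim_le_codim_small_eigenvalues[OF P W ge] i show False by simp
qed

subsection \<open>Limits of quotients of matrices\<close>

text \<open>The norm of a matrix as a vector of rows is the Frobenius norm, so Cauchy-Schwarz in
  each row suffices.\<close>

lemma norm_matrix_vector_mult_le:
  fixes A :: "real^'n^'m"
  shows "norm (A *v x) \<le> norm A * norm x"
proof -
  have "norm (A *v x) = L2_set (\<lambda>i. \<bar>A $ i \<bullet> x\<bar>) UNIV"
    by (simp add: norm_vec_def matrix_vector_mul_component)
  also have "\<dots> \<le> L2_set (\<lambda>i. norm (A $ i) * norm x) UNIV"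
    by (intro L2_set_mono) (auto simp: Cauchy_Schwarz_ineq2)
  also have "\<dots> = norm A * norm x"
    by (simp add: norm_vec_def L2_set_left_distrib)
  finally show ?thesis .
qed

text \<open>The point is uniformity: the quantifier over \<open>u\<close> stands inside the
  eventuality.\<close>

lemma eventually_matrix_vector_mult_close:
  fixes q :: "'b \<Rightarrow> real^'n^'m"
  assumes "(q \<longlongrightarrow> Q) F" "e > 0"
  shows "\<forall>\<^sub>F x in F. \<forall>u. norm (q x *v u - Q *v u) \<le> e * norm u"
proof -
  have "\<forall>\<^sub>F x in F. dist (q x) Q < e" using assms by (rule tendstoD)
  then show ?thesis
  proof eventually_elim
    case (elim x)
    show ?case
    proof
      fix u
      have "norm (q x *v u - Q *v u) \<le> norm (q x - Q) * norm u"
        by (metis matrix_vector_mult_diff_rdistrib norm_matrix_vector_mult_le)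
      also have "\<dots> \<le> e * norm u"
        using elim by (intro mult_right_mono) (auto simp: dist_norm)
      finally show "norm (q x *v u - Q *v u) \<le> e * norm u" .
    qed
  qed
qed

text \<open>An injective linear map on a finite-dimensional subspace is bounded below. Half of the
  bound \<open>e\<close> for the limit \<open>Q\<close> survives once \<open>q x\<close> is within
  \<open>e / 2\<close> of \<open>Q\<close>.\<close>

lemma eventually_matrix_vector_mult_bounded_below:
  fixes q :: "'b \<Rightarrow> real^'n^'m"
  assumes q: "(q \<longlongrightarrow> Q) F" and U: "subspace U" and inj: "\<And>u. u \<in> U \<Longrightarrow> Q *v u = 0 \<Longrightarrow> u = 0"
  obtains c where "c > 0" "\<forall>\<^sub>F x in F. \<forall>u\<in>U. c * norm u \<le> norm (q x *v u)"
proof -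
  have "\<exists>e>0. \<forall>u\<in>U. norm (Q *v u) \<ge> e * norm u"
    using U inj by (intro injective_imp_isometric closed_subspace matrix_vector_mul_bounded_linear) auto
  then obtain e where e: "e > 0" "\<And>u. u \<in> U \<Longrightarrow> e * norm u \<le> norm (Q *v u)" by auto
  have "\<forall>\<^sub>F x in F. \<forall>u. norm (q x *v u - Q *v u) \<le> (e / 2) * norm u"
    using q e(1) by (intro eventually_matrix_vector_mult_close) auto
  then have "\<forall>\<^sub>F x in F. \<forall>u\<in>U. (e / 2) * norm u \<le> norm (q x *v u)"
  proof eventually_elim
    case (elim x)
    show ?case
    proof
      fix u assume "u \<in> U"
      from e(2)[OF this] elim[rule_format, of u] show "e / 2 * norm u \<le> norm (q x *v u)"
        using norm_triangle_ineq2[of "Q *v u" "q x *v u"] by (simp add: norm_minus_commute field_simps)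
    qed
  qed
  with e(1) that[of "e / 2"] show thesis by simp
qed

lemma matrix_inv_cancel:
  assumes "invertible A"
  shows "A ** matrix_inv A = mat 1" "matrix_inv A ** A = mat 1"
proof -
  have "\<exists>B. A ** B = mat 1 \<and> B ** A = mat 1" using assms by (simp add: invertible_def)
  from someI_ex[OF this] show "A ** matrix_inv A = mat 1" "matrix_inv A ** A = mat 1"
    by (auto simp: matrix_inv_def)
qed

text \<open>With \<open>r\<close> the inverse of \<open>q\<close>, the matrix \<open>p ** r\<close>
  is the congruence by \<open>r\<close> of \<open>transpose q ** p\<close>, which is symmetric by
  assumption.\<close>

lemma transpose_mult_matrix_inv:
  fixes q p :: "'a::comm_semiring_1^'n^'n"
  assumes "invertible q" "transpose q ** p = transpose p ** q"
  shows "transpose (p ** matrix_inv q) = p ** matrix_inv q"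
proof -
  let ?r = "matrix_inv q"
  have "transpose ?r ** transpose q = mat 1"
    using matrix_inv_cancel(1)[OF assms(1)] by (metis matrix_transpose_mul transpose_mat)
  then have "p ** ?r = transpose ?r ** (transpose q ** p) ** ?r"
    by (simp add: matrix_mul_assoc)
  also have "\<dots> = transpose ?r ** transpose p ** (q ** ?r)"
    by (simp add: assms(2) matrix_mul_assoc)
  also have "\<dots> = transpose (p ** ?r)"
    by (simp add: matrix_inv_cancel[OF assms(1)] matrix_transpose_mul)
  finally show ?thesis by simp
qed

lemma subspace_matrix_kernel: "subspace {v. A *v v = 0}" for A :: "real^'n^'m"
  by (auto simp: subspace_def matrix_vector_right_distrib matrix_vector_mult_scaleR)

text \<open>\<open>A\<close> maps the orthogonal complement of its kernel bijectively onto its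
  range.\<close>

lemma rank_nullity:
  fixes A :: "real^'n^'m"
  shows "rank A + dim {v. A *v v = 0} = CARD('n)"
proof -
  let ?K = "{v. A *v v = 0}"
  let ?U = "{y \<in> UNIV. \<forall>x\<in>?K. orthogonal x y}"
  have dim: "dim ?U + dim ?K = CARD('n)"
    using dim_subspace_orthogonal_to_vectors[OF subspace_matrix_kernel subspace_UNIV, of A] by simp
  have U: "subspace ?U" by (auto simp: subspace_def orthogonal_def inner_simps)
  have "inj_on ((*v) A) ?U"
  proof (rule inj_onI)
    fix x y assume "x \<in> ?U" "y \<in> ?U" "A *v x = A *v y"
    then have "x - y \<in> ?U" "x - y \<in> ?K"
      using subspace_diff[OF U, of x y] by (auto simp: matrix_vector_mult_diff_distrib)
    then have "orthogonal (x - y) (x - y)" by blast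
    then show "x = y" by (simp add: orthogonal_self)
  qed
  then have "dim ((*v) A ` ?U) = dim ?U"
    using U by (intro dim_image_eq matrix_vector_mul_linear) (simp add: span_eq_iff[THEN iffD2])
  moreover have "(*v) A ` ?U = range ((*v) A)"
  proof -
    have "A *v v \<in> (*v) A ` ?U" for v
    proof -
      obtain y z where "y \<in> span ?K" "\<And>w. w \<in> span ?K \<Longrightarrow> orthogonal z w" "v = y + z"
        using orthogonal_subspace_decomp_exists[of ?K v] by metis
      moreover have "span ?K = ?K" using subspace_matrix_kernel by (simp add: span_eq_iff)
      ultimately have "A *v v = A *v z" "z \<in> ?U"
        by (auto simp: matrix_vector_right_distrib orthogonal_commute)
      then show ?thesis by blast
    qed
    then show ?thesis by auto
  qed
  ultimately show ?thesis using dim by (simp add: rank_dim_range)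
qed

text \<open>The two min-max bounds are applied to the images under \<open>q x\<close> of the kernel
  of \<open>Q\<close>, which has codimension \<open>rank Q\<close>, and of its orthogonal
  complement, which has dimension \<open>rank Q\<close>. Labels start at 0, so the bounded
  eigenvalues are exactly those with label below \<open>rank Q\<close>.\<close>

lemma eigenvalues_by_abs_quotient_limit:
  fixes q p :: "'b \<Rightarrow> real^'n^'n"
  assumes q: "(q \<longlongrightarrow> Q) F" and p: "(p \<longlongrightarrow> R) F" and F: "F \<noteq> bot"
    and inv: "\<forall>\<^sub>F x in F. invertible (q x)"
    and sym: "\<And>x. transpose (q x) ** p x = transpose (p x) ** q x"
    and ker: "\<And>v. Q *v v = 0 \<Longrightarrow> R *v v = 0 \<Longrightarrow> v = 0"
    and i: "i < CARD('n)"
  shows "filterlim (\<lambda>x. \<bar>eigenvalues_by_abs (p x ** matrix_inv (q x)) ! i\<bar>) at_top F \<longleftrightarrow> rank Q \<le> i"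
proof -
  let ?e = "\<lambda>x. \<bar>eigenvalues_by_abs (p x ** matrix_inv (q x)) ! i\<bar>"
  let ?K = "{v. Q *v v = 0}"
  have dimK: "dim ?K = CARD('n) - rank Q" using rank_nullity[of Q] by simp
  have image: "subspace ((*v) (q x) ` U)" "dim ((*v) (q x) ` U) = dim U"
    if "invertible (q x)" "subspace U" for x U
  proof -
    show "subspace ((*v) (q x) ` U)" using that(2) by (intro linear_subspace_image matrix_vector_mul_linear)
    show "dim ((*v) (q x) ` U) = dim U"
      using inj_matrix_vector_mult[OF that(1)]
      by (intro dim_image_eq matrix_vector_mul_linear) (auto intro: inj_on_subset)
  qed
  have s: "(p x ** matrix_inv (q x)) *v (q x *v u) = p x *v u" if "invertible (q x)" for x u
  proof -
    have "p x ** matrix_inv (q x) ** q x = p x"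
      by (simp add: matrix_inv_cancel[OF that] flip: matrix_mul_assoc)
    then show ?thesis by (simp add: matrix_vector_mul_assoc)
  qed
  have "filterlim ?e at_top F" if "rank Q \<le> i"
  proof -
    obtain c where c: "c > 0" "\<forall>\<^sub>F x in F. \<forall>u\<in>?K. c * norm u \<le> norm (p x *v u)"
      using eventually_matrix_vector_mult_bounded_below[OF p subspace_matrix_kernel[of Q]] ker
      by blast
    show ?thesis
      unfolding filterlim_at_top_gt[where c = 0]
    proof (intro allI impI)
      fix M :: real assume M: "0 < M"
      \<comment> \<open>On the kernel of \<open>Q\<close> this reads
        \<open>norm (q x *v u) \<le> (c / M) * norm u\<close>. Together with
        \<open>c * norm u \<le> norm (p x *v u)\<close> it makes the quotient at least
        \<open>M\<close>.\<close>
      with c have "\<forall>\<^sub>F x in F. \<forall>u. norm (q x *v u - Q *v u) \<le> (c / M) * norm u"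
        by (intro eventually_matrix_vector_mult_close q) auto
      with inv c(2) show "\<forall>\<^sub>F x in F. M \<le> ?e x"
      proof eventually_elim
        case (elim x)
        show ?case
        proof (rule eigenvalues_by_abs_ge)
          show "subspace ((*v) (q x) ` ?K)" by (intro image subspace_matrix_kernel elim)
          show "transpose (p x ** matrix_inv (q x)) = p x ** matrix_inv (q x)"
            by (intro transpose_mult_matrix_inv elim sym)
          show "CARD('n) - dim ((*v) (q x) ` ?K) \<le> i"
            using that by (simp add: image elim subspace_matrix_kernel dimK)
          show "i < CARD('n)" by fact
          fix w assume "w \<in> (*v) (q x) ` ?K"
          then obtain u where u: "u \<in> ?K" "w = q x *v u" by auto
          then have "M * norm w \<le> c * norm u"
            using elim(3)[rule_format, of u] M by (simp add: field_simps)
          with elim(2) u show "M * norm w \<le> norm ((p x ** matrix_inv (q x)) *v w)"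
            using s[OF elim(1), of u] by force
        qed
      qed
    qed
  qed
  moreover have "\<not> filterlim ?e at_top F" if "i < rank Q"
  proof
    assume lim: "filterlim ?e at_top F"
    let ?U = "{y \<in> UNIV. \<forall>x\<in>?K. orthogonal x y}"
    have dimU: "dim ?U = rank Q"
      using dim_subspace_orthogonal_to_vectors[OF subspace_matrix_kernel subspace_UNIV, of Q]
        rank_nullity[of Q] by simp
    have U: "subspace ?U" by (auto simp: subspace_def orthogonal_def inner_simps)
    have ker_U: "u = 0" if "u \<in> ?U" "Q *v u = 0" for u
      using that by (auto simp: orthogonal_self)
    obtain c where c: "c > 0" "\<forall>\<^sub>F x in F. \<forall>u\<in>?U. c * norm u \<le> norm (q x *v u)"
      using eventually_matrix_vector_mult_bounded_below[OF q U ker_U] by blast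
    \<comment> \<open>\<open>C\<close> bounds \<open>p x\<close> near the limit:
      \<open>norm R\<close> for the limit itself and 1 for the deviation from it.\<close>
    define C where "C = norm R + 1"
    have C: "C > 0" by (simp add: C_def add_nonneg_pos)
    have "\<forall>\<^sub>F x in F. \<forall>u. norm (p x *v u - R *v u) \<le> 1 * norm u"
      by (intro eventually_matrix_vector_mult_close p) auto
    \<comment> \<open>The threshold lies above the bound \<open>C / c\<close> derived below, so the
      two clash wherever both hold; as \<open>F\<close> is not trivial, there is such a
      point.\<close>
    moreover have "\<forall>\<^sub>F x in F. C / c + 1 \<le> ?e x"
      using lim by (simp add: filterlim_at_top)
    ultimately have "\<forall>\<^sub>F x in F. False"
      using inv c(2)
    proof eventually_elim
      case (elim x)
      have "?e x \<le> C / c"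
      proof (rule eigenvalues_by_abs_le)
        show "subspace ((*v) (q x) ` ?U)" by (intro image U elim)
        show "transpose (p x ** matrix_inv (q x)) = p x ** matrix_inv (q x)"
          by (intro transpose_mult_matrix_inv elim sym)
        show "i < dim ((*v) (q x) ` ?U)"
          using image(2)[OF elim(3) U] dimU that by simp
        show "0 \<le> C / c" using C c by simp
        fix w assume "w \<in> (*v) (q x) ` ?U"
        then obtain u where u: "u \<in> ?U" "w = q x *v u" by auto
        have "norm (p x *v u) \<le> norm (R *v u) + norm u"
          using elim(1)[rule_format, of u] norm_triangle_sub[of "p x *v u" "R *v u"] by simp
        also have "\<dots> \<le> C * norm u"
          using norm_matrix_vector_mult_le[of R u] by (simp add: C_def algebra_simps)
        also have "\<dots> \<le> C / c * norm w"
        proof -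
          have "c * norm u \<le> norm w" using elim(4) u by blast
          then show ?thesis using C c(1) by (simp add: field_simps)
        qed
        finally show "norm ((p x ** matrix_inv (q x)) *v w) \<le> C / c * norm w"
          using s[OF elim(3), of u] u by simp
      qed
      with elim(2) show False by simp
    qed
    with F show False by simp
  qed
  ultimately show ?thesis by (meson not_le)
qed

subsection \<open>Symplectic frames and crossings\<close>

definition vec_pair :: "'a^'n \<Rightarrow> 'a^'m \<Rightarrow> 'a^('n + 'm)"
  where "vec_pair x y = (\<chi> i. case i of Inl k \<Rightarrow> x $ k | Inr k \<Rightarrow> y $ k)"

lemma vec_pair_eq_iff [simp]: "vec_pair x y = vec_pair x' y' \<longleftrightarrow> x = x' \<and> y = y'"
  by (auto simp: vec_pair_def vec_eq_iff split: sum.splits)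

lemma vec_pair_0 [simp]: "vec_pair 0 0 = 0"
  by (auto simp: vec_pair_def vec_eq_iff split: sum.splits)

lemma vec_pair_eq_0_iff [simp]: "vec_pair x y = 0 \<longleftrightarrow> x = 0 \<and> y = 0"
  using vec_pair_eq_iff[of x y 0 0] by simp

lemma vec_pair_exhaust: obtains x y where "v = vec_pair x y"
proof
  show "v = vec_pair (\<chi> i. v $ Inl i) (\<chi> i. v $ Inr i)"
    by (auto simp: vec_pair_def vec_eq_iff split: sum.splits)
qed

lemma frame_mat_mult_vec: "frame_mat q p *v v = vec_pair (q *v v) (p *v v)"
  by (auto simp: vec_pair_def frame_mat_def vec_eq_iff matrix_vector_mult_def split: sum.splits)

lemma total_frame_mult_vec: "total_frame q p *v vec_pair v w = vec_pair (q *v v) (p *v v + w)"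
proof -
  have "(\<Sum>j\<in>UNIV. g j) = (\<Sum>k\<in>UNIV. g (Inl k)) + (\<Sum>k\<in>UNIV. g (Inr k))"
    for g :: "'a + 'a \<Rightarrow> real"
    by (simp add: UNIV_Plus_UNIV[symmetric] sum.Plus del: UNIV_Plus_UNIV)
  then show ?thesis
    by (auto simp: vec_pair_def total_frame_def block_mat_def vec_eq_iff matrix_vector_mult_def
        mat_def if_distrib[of "\<lambda>x. x * _"] split: sum.splits cong: if_cong)
qed

lemma span_columns: "span (columns A) = range ((*v) A)" for A :: "real^'n^'m"
proof
  show "span (columns A) \<subseteq> range ((*v) A)"
    by (intro span_minimal linear_subspace_image matrix_vector_mul_linear subspace_UNIV)
      (auto simp: columns_image_basis)
  show "range ((*v) A) \<subseteq> span (columns A)" by (auto simp: matrix_vector_mult_in_columnspace)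
qed

text \<open>The reference plane consists of the vectors with vanishing upper half, and the upper
  half of the frame applied to \<open>v\<close> is \<open>q *v v\<close>.\<close>

lemma frame_plane_Int_reference_plane:
  "frame_plane q p \<inter> reference_plane = (*v) (frame_mat q p) ` {v. q *v v = 0}"
  unfolding frame_plane_def reference_plane_def span_columns
  by (auto simp: frame_mat_mult_vec)

lemma inj_frame_mat: "symplectic_frame q p \<Longrightarrow> inj ((*v) (frame_mat q p))"
  by (simp add: symplectic_frame_def full_rank_injective)

lemma dim_frame_plane_Int_reference_plane:
  fixes q p :: "real^'n^'n"
  assumes "symplectic_frame q p"
  shows "dim (frame_plane q p \<inter> reference_plane) = CARD('n) - rank q"
proof -
  have "dim (frame_plane q p \<inter> reference_plane) = dim {v. q *v v = 0}"
    unfolding frame_plane_Int_reference_plane using inj_frame_mat[OF assms]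
    by (intro dim_image_eq matrix_vector_mul_linear) (auto intro: inj_on_subset)
  then show ?thesis using rank_nullity[of q] by simp
qed

lemma frame_plane_Int_reference_plane_trivial_iff:
  fixes q p :: "real^'n^'n"
  assumes "symplectic_frame q p"
  shows "frame_plane q p \<inter> reference_plane = {0} \<longleftrightarrow> invertible q"
proof -
  have "frame_plane q p \<inter> reference_plane = {0} \<longleftrightarrow> {v. q *v v = 0} = {0}"
    unfolding frame_plane_Int_reference_plane
    using inj_image_eq_iff[OF inj_frame_mat[OF assms], of "{v. q *v v = 0}" "{0}"] by simp
  also have "\<dots> \<longleftrightarrow> invertible q"
    by (auto simp: invertible_left_inverse matrix_left_invertible_ker)
  finally show ?thesis .
qed

text \<open>The kernel of the total frame matrix is the graph of \<open>v\<close> to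
  \<open>- (p *v v)\<close> over the kernel of \<open>q\<close>, so both kernels have the same
  dimension.\<close>

lemma rank_total_frame:
  fixes q p :: "real^'n^'n"
  shows "2 * CARD('n) - rank (total_frame q p) = CARD('n) - rank q"
proof -
  let ?g = "\<lambda>v. vec_pair v (- (p *v v))"
  have "{v. total_frame q p *v v = 0} = ?g ` {v. q *v v = 0}" (is "?L = ?R")
  proof (intro equalityI subsetI)
    fix v assume "v \<in> ?L"
    then show "v \<in> ?R"
      by (cases v rule: vec_pair_exhaust) (auto simp: total_frame_mult_vec add_eq_0_iff)
  qed (auto simp: total_frame_mult_vec)
  moreover have "dim (?g ` {v. q *v v = 0}) = dim {v. q *v v = 0}"
  proof (rule dim_image_eq)
    show "linear ?g"
      by (rule linearI) (auto simp: vec_pair_def vec_eq_iff matrix_vector_right_distrib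
          matrix_vector_mult_scaleR split: sum.splits)
  qed (auto simp: inj_on_def)
  ultimately have "rank (total_frame q p) + dim {v. q *v v = 0} = 2 * CARD('n)"
    using rank_nullity[of "total_frame q p"] by (simp add: card_UNIV_sum)
  then show ?thesis using rank_nullity[of q] by simp
qed

section \<open>The unsigned jump at an isolated crossing\<close>

text \<open>Near \<open>x0\<close> the index is constant on either side, and passing
  \<open>x0\<close> adds exactly one term to the sum.\<close>

lemma isolated_crossing_jump:
  assumes disc: "discrete (crossings L V)" and cl: "closed (crossings L V)"
    and x0: "x0 \<in> crossings L V"
  shows "has_unsigned_maslov_jump L V x0 (dim (L x0 \<inter> V))"
  unfolding has_unsigned_maslov_jump_def
proof (intro allI impI)
  fix a assume a: "a < x0"
  let ?C = "crossings L V"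
  let ?m = "\<lambda>x. dim (L x \<inter> V)"
  obtain e where e: "e > 0" "\<And>y. y \<in> ?C \<Longrightarrow> dist x0 y < e \<Longrightarrow> y = x0"
    using discreteD[OF disc x0] unfolding isolated_in_dist_Ex_iff by auto
  \<comment> \<open>Finiteness matters: a sum over an infinite set would be 0 by default. It follows
    since a compact discrete set is finite.\<close>
  have fin: "finite (?C \<inter> {a..x0})"
  proof -
    have "compact (?C \<inter> {a..x0})" using cl by (simp add: closed_Int_compact)
    moreover have "discrete (?C \<inter> {a..x0})"
      using disc by (auto simp: discrete_def isolated_in_islimpt_iff intro: islimpt_subset)
    ultimately show ?thesis by (simp flip: discrete_compact_finite_iff)
  qed
  define l where "l = sum ?m (?C \<inter> {a..<x0})"
  have "unsigned_maslov_index L V a x = l" if "max a (x0 - e) < x" "x < x0" for x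
  proof -
    have "?C \<inter> {a..x} = ?C \<inter> {a..<x0}"
      using that e(2) by (force simp: dist_real_def)
    then show ?thesis by (simp add: unsigned_maslov_index_def l_def)
  qed
  then have "\<forall>\<^sub>F x in at_left x0. unsigned_maslov_index L V a x = l"
    using a e(1) unfolding eventually_at_left[OF a] by (intro exI[of _ "max a (x0 - e)"]) auto
  moreover have "unsigned_maslov_index L V a x = l + ?m x0" if "x0 < x" "x < x0 + e" for x
  proof -
    have "?C \<inter> {a..x} = insert x0 (?C \<inter> {a..<x0})"
      using that a x0 e(2) by (force simp: dist_real_def)
    moreover have "finite (?C \<inter> {a..<x0})" by (rule finite_subset[OF _ fin]) auto
    ultimately show ?thesis by (simp add: unsigned_maslov_index_def l_def)
  qed
  then have "\<forall>\<^sub>F x in at_right x0. unsigned_maslov_index L V a x = l + ?m x0"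
    using e(1) unfolding eventually_at_right[OF less_add_one] by (intro exI[of _ "x0 + e"]) auto
  ultimately show "\<exists>l r. (unsigned_maslov_index L V a \<longlongrightarrow> l) (at_left x0) \<and>
      (unsigned_maslov_index L V a \<longlongrightarrow> r) (at_right x0) \<and> r = l + ?m x0"
    using tendsto_eventually by blast
qed

text \<open>Crossings are the points where \<open>q\<close> is singular, and invertibility is an
  open condition. Discreteness alone would still let crossings accumulate at a point that is not a
  crossing; closedness excludes this.\<close>

lemma closed_crossings_reference_plane:
  fixes q p :: "real \<Rightarrow> real^'n^'n"
  assumes frame: "\<And>x. symplectic_frame (q x) (p x)" and cont: "\<And>x. isCont q x"
  shows "closed (crossings (\<lambda>x. frame_plane (q x) (p x)) reference_plane)" (is "closed ?C")
proof -
  have C: "x \<notin> ?C \<longleftrightarrow> invertible (q x)" for x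
    by (simp add: crossings_def frame_plane_Int_reference_plane_trivial_iff[OF frame])
  have ker: "invertible B \<longleftrightarrow> (\<forall>v. B *v v = 0 \<longrightarrow> v = 0)" for B :: "real^'n^'n"
    by (simp add: invertible_left_inverse matrix_left_invertible_ker)
  have "\<forall>\<^sub>F y in nhds x. y \<in> - ?C" if "x \<in> - ?C" for x
  proof -
    have "(q \<longlongrightarrow> q x) (nhds x)" using cont by (simp add: isCont_def tendsto_at_iff_tendsto_nhds)
    moreover have "u = 0" if "q x *v u = 0" for u
      using \<open>x \<in> - ?C\<close> that by (simp add: C ker)
    ultimately obtain c where "c > 0"
      and "\<forall>\<^sub>F y in nhds x. \<forall>u\<in>UNIV. c * norm u \<le> norm (q y *v u)"
      using eventually_matrix_vector_mult_bounded_below[OF _ subspace_UNIV] by blast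
    from this(2) show ?thesis
    proof eventually_elim
      case (elim y)
      have "v = 0" if "q y *v v = 0" for v
        using elim[rule_format, of v] that \<open>c > 0\<close> by (simp add: mult_le_0_iff)
      then show ?case by (simp add: C ker)
    qed
  qed
  then have "open (- ?C)"
    by (subst open_subopen) (auto simp: eventually_nhds subset_iff Ball_def)
  then show ?thesis by (simp add: closed_def)
qed

lemma isCont_frame_mat_imp:
  assumes "isCont (\<lambda>t. frame_mat (q t) (p t)) x"
  shows "isCont q x" "isCont p x"
proof -
  have *: "(\<lambda>t. q t $ k) = (\<lambda>t. frame_mat (q t) (p t) $ Inl k)"
    "(\<lambda>t. p t $ k) = (\<lambda>t. frame_mat (q t) (p t) $ Inr k)" for k
    by (simp_all add: frame_mat_def)
  have "isCont (\<lambda>t. q t $ k) x" "isCont (\<lambda>t. p t $ k) x" for k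
    unfolding * by (intro continuous_component assms)+
  then show "isCont q x" "isCont p x"
    by (auto simp: isCont_def intro: vec_tendstoI)
qed

theorem theorem4p1:
  fixes A :: "real \<Rightarrow> real^('n::finite + 'n)^('n + 'n)"
    and q p s :: "real \<Rightarrow> real^'n^'n"
    and L :: "real \<Rightarrow> (real^('n + 'n)) set"
    and x0 :: real
  assumes A_cont: "continuous_on UNIV A"
    and A_sp: "\<And>x. A x \<in> sp_algebra"
    and frame: "\<And>x. symplectic_frame (q x) (p x)"
    and ode: "\<And>x. ((\<lambda>t. frame_mat (q t) (p t)) has_vector_derivative
                     A x ** frame_mat (q x) (p x)) (at x)"
    and L: "\<And>x. L x = frame_plane (q x) (p x)"
    and s: "\<And>x. s x = p x ** matrix_inv (q x)"
    and isolated: "discrete (crossings L reference_plane)"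
    and x0: "x0 \<in> crossings L reference_plane"
  shows "has_unsigned_maslov_jump L reference_plane x0 (CARD('n) - rank (q x0))
    \<and> CARD('n) - rank (q x0) = 2 * CARD('n) - rank (total_frame (q x0) (p x0))
    \<and> 2 * CARD('n) - rank (total_frame (q x0) (p x0)) = dim (L x0 \<inter> reference_plane)
    \<and> dim (L x0 \<inter> reference_plane) = card (singular_eigenvalue_indices s x0)"
proof -
  let ?C = "crossings L reference_plane"
  have cont: "isCont q x" "isCont p x" for x
    using isCont_frame_mat_imp[OF has_vector_derivative_continuous[OF ode]] by auto
  have L': "L = (\<lambda>x. frame_plane (q x) (p x))" using L by auto
  have dim: "dim (L x0 \<inter> reference_plane) = CARD('n) - rank (q x0)"
    by (simp add: L dim_frame_plane_Int_reference_plane[OF frame])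
  have "closed ?C" unfolding L' using frame cont by (intro closed_crossings_reference_plane)
  note jump = isolated_crossing_jump[OF isolated this x0]
  \<comment> \<open>Isolation makes \<open>q x\<close> invertible at all nearby points other than
    \<open>x0\<close>, so \<open>matrix_inv\<close> is a true inverse there. At \<open>x0\<close>
    its value is irrelevant to the limit.\<close>
  have "\<forall>\<^sub>F x in at x0. x \<notin> ?C"
    using discreteD[OF isolated x0] by (simp add: isolated_in_islimpt_iff islimpt_iff_eventually)
  then have inv: "\<forall>\<^sub>F x in at x0. invertible (q x)"
    by eventually_elim (simp add: crossings_def L frame_plane_Int_reference_plane_trivial_iff[OF frame])
  have "filterlim (\<lambda>x. \<bar>eigenvalues_by_abs (s x) ! i\<bar>) at_top (at x0) \<longleftrightarrow> rank (q x0) \<le> i"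
    if "i < CARD('n)" for i
    unfolding s
  proof (rule eigenvalues_by_abs_quotient_limit)
    show "q \<midarrow>x0\<rightarrow> q x0" "p \<midarrow>x0\<rightarrow> p x0" using cont by (auto simp: isCont_def)
    show "transpose (q x) ** p x = transpose (p x) ** q x" for x
      using frame by (simp add: symplectic_frame_def)
    \<comment> \<open>Full rank of the frame: a vector killed by both halves is zero.\<close>
    show "v = 0" if "q x0 *v v = 0" "p x0 *v v = 0" for v
      using that injD[OF inj_frame_mat[OF frame], of x0 v 0] by (simp add: frame_mat_mult_vec)
  qed (use inv that in auto)
  \<comment> \<open>The singular labels are the last \<open>CARD('n) - rank (q x0)\<close>
    ones.\<close>
  then have "singular_eigenvalue_indices s x0 = {rank (q x0)..<CARD('n)}"
    by (auto simp: singular_eigenvalue_indices_def)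
  with jump dim show ?thesis by (simp add: rank_total_frame)
qed

end
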